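(* Let $d\ge 1$, let $U:\mathbb{R}^d\to\mathbb{R}$ be such that $\pi(x)\propto e^{-U(x)}$ is a probability density on $\mathbb{R}^d$, and assume that $\nabla U\in L^1(\pi)\cap L^l_{\mathrm{loc}}(\pi)$ for some $l>d$. Let $T(t)$ and $p_t(x,y)$ be the semigroup and the transition density relative to $\pi$ of the reversible diffusion $dX(t)=-\nabla U(X(t))\,dt+\sqrt2\,dW(t)$. Let $\rho\in\mathbb{R}$. If there exists some $g\in L^1_{\mathrm{loc}}(\pi)$ such that $$\int_{\mathbb{R}^d}|p_t(x,y)-1|\,\pi(y)\,dy\le g(x)\,e^{\rho t}\qquad\text{for all }x\in\mathbb{R}^d,\ t>0,$$ then $$\|T(t)-\pi\|\le e^{\rho t}\qquad\text{for all }t>0.$$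
   Context: The symbol $\pi$ denotes the probability density proportional to $e^{-U}$, the corresponding probability measure, and also the operator $f\mapsto\pi(f)=\int f\,\pi\,dx$ (mapping $f$ to a constant function) on $L^2(\pi)$. The function $U$ is regular enough that $\nabla U$ makes sense (at least weakly). $W$ is a Brownian motion in $\mathbb{R}^d$. It is a standing assumption (guaranteed by the hypothesis on $\nabla U$) that the diffusion does not explode, that $\pi$ is its equilibrium distribution, and that its transition density $p(t,x,y)$ exists. $T(t)f(x)=E_xf(X(t))=\int p(t,x,y)f(y)\,dy$ is the associated Markov semigroup on $L^2(\pi)$, and $$p_t(x,y)=\frac{p(t,x,y)}{\pi(y)}.$$ The norm $\|\cdot\|$ of an operator is the operator norm from $L^2(\pi)$ to $L^2(\pi)$. *)

theory Defs
  imports "HOL-Probability.Probability"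
begin

section \<open>Weak gradients and local integrability\<close>

primrec Ck :: "nat \<Rightarrow> (real^'n \<Rightarrow> real) \<Rightarrow> bool" where
  "Ck 0 f \<longleftrightarrow> continuous_on UNIV f"
| "Ck (Suc k) f \<longleftrightarrow> f differentiable_on UNIV \<and>
     (\<forall>i. Ck k (\<lambda>x. frechet_derivative f (at x) (axis i 1)))"

definition test_function :: "(real^'n \<Rightarrow> real) \<Rightarrow> bool" where
  "test_function f \<longleftrightarrow> (\<forall>k. Ck k f) \<and> compact (closure {x. f x \<noteq> 0})"

definition locally_Lp :: "'a::euclidean_space measure \<Rightarrow> real \<Rightarrow> ('a \<Rightarrow> 'b::euclidean_space) \<Rightarrow> bool" where
  "locally_Lp M q f \<longleftrightarrow> f \<in> borel_measurable M \<and>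
     (\<forall>K. compact K \<longrightarrow> set_integrable M K (\<lambda>x. norm (f x) powr q))"

definition weak_gradient :: "(real^'n \<Rightarrow> real) \<Rightarrow> (real^'n \<Rightarrow> real^'n) \<Rightarrow> bool" where
  "weak_gradient u Du \<longleftrightarrow> locally_Lp lborel 1 u \<and> locally_Lp lborel 1 Du \<and>
     (\<forall>\<phi> i. test_function \<phi> \<longrightarrow>
        (\<integral>x. u x * frechet_derivative \<phi> (at x) (axis i 1) \<partial>lborel)
          = - (\<integral>x. (Du x $ i) * \<phi> x \<partial>lborel))"


section \<open>The equilibrium measure\<close>

definition gibbs_density :: "(real^'n \<Rightarrow> real) \<Rightarrow> real^'n \<Rightarrow> real" where
  "gibbs_density U x = exp (- U x) / (\<integral>y. exp (- U y) \<partial>lborel)"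

definition gibbs_measure :: "(real^'n \<Rightarrow> real) \<Rightarrow> (real^'n) measure" where
  "gibbs_measure U = density lborel (\<lambda>x. ennreal (gibbs_density U x))"


section \<open>Operators on \<open>L\<^sup>2\<close>\<close>

text \<open>Elements of \<open>L\<^sup>2(M)\<close> are represented by measurable functions, not by classes modulo
  null sets.  The operator norm is extended-valued: it is infinite if the operator does not map
  \<open>L\<^sup>2(M)\<close> into itself or is unbounded.\<close>

definition L2 :: "'a measure \<Rightarrow> ('a \<Rightarrow> real) set" where
  "L2 M = {f \<in> borel_measurable M. integrable M (\<lambda>x. (f x)\<^sup>2)}"

definition L2_norm :: "'a measure \<Rightarrow> ('a \<Rightarrow> real) \<Rightarrow> real" where
  "L2_norm M f = sqrt (\<integral>x. (f x)\<^sup>2 \<partial>M)"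

definition L2_opnorm :: "'a measure \<Rightarrow> (('a \<Rightarrow> real) \<Rightarrow> 'a \<Rightarrow> real) \<Rightarrow> ennreal" where
  "L2_opnorm M A =
     Inf {ennreal C | C. 0 \<le> C \<and> (\<forall>f\<in>L2 M. A f \<in> L2 M \<and> L2_norm M (A f) \<le> C * L2_norm M f)}"


section \<open>Diffusions with additive noise\<close>

text \<open>Time is the half-line \<open>t \<ge> 0\<close>; values at negative times are irrelevant.\<close>

locale brownian_motion =
  prob_space M + filtration "space M" F
  for M :: "'w measure" and F :: "real \<Rightarrow> 'w measure" and W :: "real \<Rightarrow> 'w \<Rightarrow> real^'n" +
  assumes subalgebra_F: "0 \<le> t \<Longrightarrow> subalgebra M (F t)"
    and adapted: "0 \<le> t \<Longrightarrow> W t \<in> borel_measurable (F t)"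
    and start: "AE \<omega> in M. W 0 \<omega> = 0"
    and continuous_paths: "AE \<omega> in M. continuous_on {0..} (\<lambda>t. W t \<omega>)"
    and gaussian_increments: "0 \<le> s \<Longrightarrow> s < t \<Longrightarrow>
      distributed M lborel (\<lambda>\<omega>. W t \<omega> - W s \<omega>)
        (\<lambda>x. ennreal (\<Prod>i\<in>UNIV. normal_density 0 (sqrt (t - s)) (x $ i)))"
    and independent_increments: "0 \<le> s \<Longrightarrow> s < t \<Longrightarrow>
      indep_set (sets (F s)) {(\<lambda>\<omega>. W t \<omega> - W s \<omega>) -` B \<inter> space M | B. B \<in> sets borel}"

text \<open>A non-explosive weak solution of \<open>dX = b(X) dt + \<sigma> dW\<close> started at \<open>x\<close>.  Since \<open>\<sigma>\<close> is a
  constant scalar, the stochastic integral is just \<open>\<sigma> W(t)\<close>.\<close>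

locale weak_solution = brownian_motion M F W
  for M :: "'w measure" and F :: "real \<Rightarrow> 'w measure" and W :: "real \<Rightarrow> 'w \<Rightarrow> real^'n" +
  fixes b :: "real^'n \<Rightarrow> real^'n" and \<sigma> :: real
    and x :: "real^'n" and X :: "real \<Rightarrow> 'w \<Rightarrow> real^'n"
  assumes adapted_X: "0 \<le> t \<Longrightarrow> X t \<in> borel_measurable (F t)"
    and sde: "AE \<omega> in M. \<forall>t\<ge>0.
      set_integrable lborel {0..t} (\<lambda>s. b (X s \<omega>)) \<and>
      X t \<omega> = x + (LBINT s:{0..t}. b (X s \<omega>)) + \<sigma> *\<^sub>R W t \<omega>"

definition transition_kernel ::
    "(real^'n \<Rightarrow> 'w measure) \<Rightarrow> (real \<Rightarrow> 'w \<Rightarrow> real^'n) \<Rightarrow> real \<Rightarrow> real^'n \<Rightarrow> (real^'n) measure" where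
  "transition_kernel P X t x = distr (P x) borel (X t)"

definition markov_semigroup ::
    "(real^'n \<Rightarrow> 'w measure) \<Rightarrow> (real \<Rightarrow> 'w \<Rightarrow> real^'n) \<Rightarrow> real \<Rightarrow> (real^'n \<Rightarrow> real) \<Rightarrow> real^'n \<Rightarrow> real" where
  "markov_semigroup P X t f x = (\<integral>\<omega>. f (X t \<omega>) \<partial>P x)"

text \<open>The diffusion \<open>dX = b(X) dt + \<sigma> dW\<close> as a time-homogeneous Markov family: under \<open>P x\<close> the
  process \<open>X\<close> is a weak solution started at \<open>x\<close>.\<close>

locale diffusion =
  fixes b :: "real^'n \<Rightarrow> real^'n" and \<sigma> :: real
    and P :: "real^'n \<Rightarrow> 'w measure" and F :: "real \<Rightarrow> 'w measure"
    and W X :: "real \<Rightarrow> 'w \<Rightarrow> real^'n"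
  assumes solution: "weak_solution (P x) F W b \<sigma> x X"
    and kernel: "0 \<le> t \<Longrightarrow> transition_kernel P X t \<in> borel \<rightarrow>\<^sub>M prob_algebra borel"
    and markov: "0 \<le> s \<Longrightarrow> 0 \<le> t \<Longrightarrow> A \<in> sets borel \<Longrightarrow>
      AE \<omega> in P x. real_cond_exp (P x) (F s) (\<lambda>\<omega>'. indicator A (X (s + t) \<omega>')) \<omega>
        = measure (transition_kernel P X t (X s \<omega>)) A"

text \<open>Detailed balance: with initial law \<open>\<mu>\<close>, the pairs \<open>(X 0, X t)\<close> and \<open>(X t, X 0)\<close> have the
  same law.  The case \<open>B = UNIV\<close> says that \<open>\<mu>\<close> is an equilibrium distribution.\<close>

definition reversible ::
    "(real^'n) measure \<Rightarrow> (real^'n \<Rightarrow> 'w measure) \<Rightarrow> (real \<Rightarrow> 'w \<Rightarrow> real^'n) \<Rightarrow> bool" where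
  "reversible \<mu> P X \<longleftrightarrow> (\<forall>t\<ge>0. \<forall>A\<in>sets borel. \<forall>B\<in>sets borel.
     (\<integral>\<^sup>+x\<in>A. emeasure (transition_kernel P X t x) B \<partial>\<mu>)
       = (\<integral>\<^sup>+x\<in>B. emeasure (transition_kernel P X t x) A \<partial>\<mu>))"

definition transition_density ::
    "(real^'n \<Rightarrow> 'w measure) \<Rightarrow> (real \<Rightarrow> 'w \<Rightarrow> real^'n) \<Rightarrow> (real \<Rightarrow> real^'n \<Rightarrow> real^'n \<Rightarrow> real) \<Rightarrow> bool" where
  "transition_density P X p \<longleftrightarrow> (\<forall>t>0. \<forall>x.
     (\<forall>y. 0 \<le> p t x y) \<and> distributed (P x) lborel (X t) (\<lambda>y. ennreal (p t x y)))"

end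

theory Submission
  imports Defs
begin

text \<open>
  Write \<open>S\<^sub>t f = T(t) f - \<pi>(f)\<close>.  Reversibility makes \<open>S\<^sub>t\<close> symmetric on \<open>L\<^sup>2(\<pi>)\<close>, and the Markov
  property gives \<open>S\<^sub>s S\<^sub>t = S\<^sub>s\<^sub>+\<^sub>t\<close>, so \<open>\<parallel>S\<^sub>t f\<parallel>\<^sup>2 = \<langle>f, S\<^sub>2\<^sub>t f\<rangle>\<close> (\<open>centred_norm_eq\<close>).  This identity is
  used in two ways.

  First, take \<open>f\<close> bounded by \<open>B\<close> and vanishing outside a compact set \<open>A\<close>.  The hypothesis bounds
  \<open>\<bar>S\<^sub>t f(x)\<bar>\<close> by \<open>B g(x) e\<^bsup>\<rho>t\<^esup>\<close>, because \<open>S\<^sub>t f(x)\<close> integrates \<open>f\<close> against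
  \<open>(p\<^sub>t(x, y) - 1) \<pi>(dy)\<close> (\<open>integral_diff_le_total_variation\<close>).  Hence
  \<open>\<parallel>S\<^sub>t f\<parallel>\<^sup>2 \<le> C e\<^bsup>2\<rho>t\<^esup>\<close> with \<open>C = B\<^sup>2 \<integral>\<^sub>A g d\<pi>\<close>: the right rate, with a constant that depends
  on \<open>f\<close> in an uncontrolled way.

  Second, the Cauchy-Schwarz inequality turns the identity into
  \<open>\<parallel>S\<^sub>t f\<parallel>\<^sup>4 \<le> \<parallel>f\<parallel>\<^sup>2 \<parallel>S\<^sub>2\<^sub>t f\<parallel>\<^sup>2\<close>.  With \<open>b(t) = \<parallel>S\<^sub>t f\<parallel>\<^sup>2 / \<parallel>f\<parallel>\<^sup>2\<close> this is \<open>b(t)\<^sup>2 \<le> b(2t)\<close>, and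
  iterating \<open>n\<close> times raises the bad constant to the power \<open>2\<^bsup>-n\<^esup>\<close>; letting \<open>n\<close> grow replaces it
  by \<open>1\<close> (\<open>exponential_bound_by_doubling\<close>, \<open>decay_of_bounded\<close>).  This plays the part of the
  spectral theorem: the log-convexity of \<open>t \<mapsto> \<parallel>S\<^sub>t f\<parallel>\<^sup>2\<close> forces any exponential rate to hold with
  the initial value as constant.

  Finally a general \<open>f\<close> in \<open>L\<^sup>2(\<pi>)\<close> is the limit of its truncations, and Fatou's lemma carries the
  bound over (\<open>decay_by_approximation\<close>).
\<close>

section \<open>Exponential bounds from doubling\<close>

text \<open>The assumptions give \<open>(b(t))\<^bsup>2^n\<^esup> \<le> b(2^n t) \<le> D e\<^bsup>c 2^n t\<^esup>\<close>, so the powers of \<open>b(t) e\<^bsup>-ct\<^esup>\<close> with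
  exponents \<open>2^n\<close> are bounded by \<open>D\<close>, which is impossible for a number greater than \<open>1\<close>.\<close>

lemma exponential_bound_by_doubling:
  fixes b :: "real \<Rightarrow> real"
  assumes nonneg: "\<And>t. 0 < t \<Longrightarrow> 0 \<le> b t"
    and doubling: "\<And>t. 0 < t \<Longrightarrow> (b t)\<^sup>2 \<le> b (2 * t)"
    and bound: "\<And>t. 0 < t \<Longrightarrow> b t \<le> D * exp (c * t)"
    and t: "0 < t"
  shows "b t \<le> exp (c * t)"
proof (rule ccontr)
  assume neg: "\<not> b t \<le> exp (c * t)"
  define r where "r = b t * exp (- (c * t))"
  have r: "1 < r"
    using neg by (simp add: r_def exp_minus field_simps)
  have pow: "b t ^ (2 ^ n) \<le> b (2 ^ n * t)" for n
  proof (induction n)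
    case (Suc n)
    have "b t ^ (2 ^ Suc n) = (b t ^ (2 ^ n))\<^sup>2"
      by (simp flip: power_mult add: mult.commute)
    also have "\<dots> \<le> (b (2 ^ n * t))\<^sup>2"
      using Suc nonneg[OF t] by (intro power_mono) auto
    also have "\<dots> \<le> b (2 * (2 ^ n * t))"
      using t by (intro doubling) simp
    finally show ?case by (simp add: mult.assoc)
  qed simp
  have le: "r ^ (2 ^ n) \<le> D" for n
  proof -
    have "r ^ (2 ^ n) = b t ^ (2 ^ n) * exp (- (c * (2 ^ n * t)))"
      by (simp add: r_def power_mult_distrib exp_of_nat_mult[symmetric] algebra_simps)
    also have "\<dots> \<le> (D * exp (c * (2 ^ n * t))) * exp (- (c * (2 ^ n * t)))"
      using pow[of n] bound[of "2 ^ n * t"] t by (intro mult_right_mono) auto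
    also have "\<dots> = D"
      by (simp add: exp_minus)
    finally show ?thesis .
  qed
  obtain n where "D < r ^ n"
    using real_arch_pow[OF r] by blast
  also have "r ^ n \<le> r ^ (2 ^ n)"
    using r by (intro power_increasing) (auto intro: less_imp_le less_exp)
  finally show False
    using le[of n] by simp
qed

section \<open>Reversible Markov kernels\<close>

lemma (in finite_measure) integral_Cauchy_Schwarz_bounded:
  fixes f h :: "'a \<Rightarrow> real"
  assumes [measurable]: "f \<in> borel_measurable M" "h \<in> borel_measurable M"
    and f: "\<And>x. x \<in> space M \<Longrightarrow> \<bar>f x\<bar> \<le> A" and h: "\<And>x. x \<in> space M \<Longrightarrow> \<bar>h x\<bar> \<le> B"
  shows "(\<integral>x. f x * h x \<partial>M)\<^sup>2 \<le> (\<integral>x. (f x)\<^sup>2 \<partial>M) * (\<integral>x. (h x)\<^sup>2 \<partial>M)"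
proof -
  have ff: "integrable M (\<lambda>x. (f x)\<^sup>2)"
  proof (rule integrable_const_bound[where B = "A\<^sup>2"])
    show "AE x in M. norm ((f x)\<^sup>2) \<le> A\<^sup>2"
      using f by (intro AE_I2) (simp add: power2_le_iff_abs_le abs_le_square_iff[symmetric], meson abs_ge_self order_trans)
  qed measurable
  have hh: "integrable M (\<lambda>x. (h x)\<^sup>2)"
  proof (rule integrable_const_bound[where B = "B\<^sup>2"])
    show "AE x in M. norm ((h x)\<^sup>2) \<le> B\<^sup>2"
      using h by (intro AE_I2) (simp add: power2_le_iff_abs_le abs_le_square_iff[symmetric], meson abs_ge_self order_trans)
  qed measurable
  have fh: "integrable M (\<lambda>x. f x * h x)"
  proof (rule integrable_const_bound[where B = "A * B"])
    show "AE x in M. norm (f x * h x) \<le> A * B"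
      using f h by (intro AE_I2) (auto simp: abs_mult intro!: mult_mono dest: order_trans[OF abs_ge_zero])
  qed measurable
  define c where "c = (\<integral>x. f x * h x \<partial>M)"
  define q where "q = (\<integral>x. (f x)\<^sup>2 \<partial>M)"
  show ?thesis
  proof (cases "q = 0")
    case True
    then have "AE x in M. (f x)\<^sup>2 = 0"
      using integral_nonneg_eq_0_iff_AE[OF ff] by (simp add: q_def)
    then have "(\<integral>x. f x * h x \<partial>M) = (\<integral>x. 0 \<partial>M)"
      by (intro integral_cong_AE) auto
    then show ?thesis
      by simp
  next
    case False
    then have q: "0 < q"
      by (simp add: q_def integral_nonneg order.not_eq_order_implies_strict)
    \<comment> \<open>Expand the square of the component of \<open>h\<close> orthogonal to \<open>f\<close>.\<close>
    have "0 \<le> (\<integral>x. (h x - c / q * f x)\<^sup>2 \<partial>M)"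
      by simp
    also have "\<dots> = (\<integral>x. (h x)\<^sup>2 - (2 * c / q) * (f x * h x) + (c / q)\<^sup>2 * (f x)\<^sup>2 \<partial>M)"
      by (intro Bochner_Integration.integral_cong) (auto simp: power2_eq_square algebra_simps)
    also have "\<dots> = (\<integral>x. (h x)\<^sup>2 \<partial>M) - (2 * c / q) * c + (c / q)\<^sup>2 * q"
      using ff hh fh by (simp add: c_def q_def)
    also have "\<dots> = (\<integral>x. (h x)\<^sup>2 \<partial>M) - c\<^sup>2 / q"
      using q by (simp add: power2_eq_square field_simps)
    finally show ?thesis
      using q by (simp add: c_def[symmetric] q_def[symmetric] field_simps)
  qed
qed

text \<open>Both sides are integrals of \<open>u \<otimes> v\<close> and \<open>v \<otimes> u\<close> against the joint law \<open>\<mu>(dx) N(x, dy)\<close> of the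
  present and the next state, and detailed balance says that this law is exchangeable.\<close>

lemma reversible_kernel_symmetric:
  fixes u v :: "'a \<Rightarrow> real"
  assumes "prob_space \<mu>"
    and N: "N \<in> \<mu> \<rightarrow>\<^sub>M prob_algebra \<mu>"
    and balance: "\<And>A B. A \<in> sets \<mu> \<Longrightarrow> B \<in> sets \<mu> \<Longrightarrow>
      (\<integral>\<^sup>+x\<in>A. emeasure (N x) B \<partial>\<mu>) = (\<integral>\<^sup>+x\<in>B. emeasure (N x) A \<partial>\<mu>)"
    and u[measurable]: "u \<in> borel_measurable \<mu>" and v[measurable]: "v \<in> borel_measurable \<mu>"
    and bu: "\<And>x. x \<in> space \<mu> \<Longrightarrow> \<bar>u x\<bar> \<le> A" and bv: "\<And>x. x \<in> space \<mu> \<Longrightarrow> \<bar>v x\<bar> \<le> B"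
  shows "(\<integral>x. u x * (\<integral>y. v y \<partial>N x) \<partial>\<mu>) = (\<integral>x. v x * (\<integral>y. u y \<partial>N x) \<partial>\<mu>)"
proof -
  interpret prob_space \<mu> by fact
  have N'[measurable]: "N \<in> \<mu> \<rightarrow>\<^sub>M subprob_algebra \<mu>"
    using N by (rule measurable_prob_algebraD)
  note sets_N = subprob_measurableD[OF N']
  define L where "L x = distr (N x) (\<mu> \<Otimes>\<^sub>M \<mu>) (Pair x)" for x
  have L[measurable]: "L \<in> \<mu> \<rightarrow>\<^sub>M subprob_algebra (\<mu> \<Otimes>\<^sub>M \<mu>)"
    unfolding L_def by (rule measurable_distr2[where M = \<mu>]) measurable
  define J where "J = \<mu> \<bind> L"
  have sets_J[measurable_cong]: "sets J = sets (\<mu> \<Otimes>\<^sub>M \<mu>)"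
    unfolding J_def by (rule sets_bind[OF subprob_measurableD(2)[OF L]]) (auto simp: not_empty)
  have rect: "emeasure J (A \<times> B) = (\<integral>\<^sup>+x\<in>A. emeasure (N x) B \<partial>\<mu>)"
    if [measurable]: "A \<in> sets \<mu>" "B \<in> sets \<mu>" for A B
  proof -
    have "emeasure J (A \<times> B) = (\<integral>\<^sup>+x. emeasure (L x) (A \<times> B) \<partial>\<mu>)"
      unfolding J_def by (rule emeasure_bind[OF not_empty L]) simp
    also have "\<dots> = (\<integral>\<^sup>+x\<in>A. emeasure (N x) B \<partial>\<mu>)"
    proof (rule nn_integral_cong)
      fix x assume x: "x \<in> space \<mu>"
      then have "Pair x \<in> N x \<rightarrow>\<^sub>M \<mu> \<Otimes>\<^sub>M \<mu>"
        by (simp add: sets_N)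
      moreover have "Pair x -` (A \<times> B) \<inter> space (N x) = (if x \<in> A then B else {})"
        using sets.sets_into_space[OF that(2)] by (auto simp: sets_N[OF x])
      ultimately show "emeasure (L x) (A \<times> B) = emeasure (N x) B * indicator A x"
        by (simp add: L_def emeasure_distr)
    qed
    finally show ?thesis .
  qed
  define J' where "J' = distr J (\<mu> \<Otimes>\<^sub>M \<mu>) (\<lambda>(x, y). (y, x))"
  have swap[measurable]: "(\<lambda>(x, y). (y, x)) \<in> J \<rightarrow>\<^sub>M \<mu> \<Otimes>\<^sub>M \<mu>"
    by measurable
  have rect': "emeasure J' (A \<times> B) = emeasure J (B \<times> A)"
    if [measurable]: "A \<in> sets \<mu>" "B \<in> sets \<mu>" for A B
  proof -
    have "(\<lambda>(x, y). (y, x)) -` (A \<times> B) \<inter> space J = B \<times> A"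
      using sets.sets_into_space[OF that(1)] sets.sets_into_space[OF that(2)]
      by (auto simp: sets_eq_imp_space_eq[OF sets_J] space_pair_measure)
    then show ?thesis
      by (simp add: J'_def emeasure_distr)
  qed
  \<comment> \<open>\<open>balance\<close> compares the two measures on rectangles, which determine them.\<close>
  have "J = J'"
  proof (rule measure_eqI_generator_eq_countable[OF Int_stable_pair_measure_generator[of \<mu> \<mu>] pair_measure_closed])
    fix X assume "X \<in> {a \<times> b |a b. a \<in> sets \<mu> \<and> b \<in> sets \<mu>}"
    then obtain A B where "X = A \<times> B" "A \<in> sets \<mu>" "B \<in> sets \<mu>"
      by auto
    then show "emeasure J X = emeasure J' X"
      using balance by (simp add: rect rect')
  next
    have "emeasure J (space \<mu> \<times> space \<mu>) \<le> (\<integral>\<^sup>+x. 1 \<partial>\<mu>)"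
      unfolding rect[OF sets.top sets.top]
      by (intro nn_integral_mono) (auto simp: sets_N(1)[symmetric] indicator_def
        intro!: subprob_space.subprob_emeasure_le_1 subprob_space_kernel[OF N'])
    then show "\<And>a. a \<in> {space \<mu> \<times> space \<mu>} \<Longrightarrow> emeasure J a \<noteq> \<infinity>"
      by (auto simp: emeasure_space_1 top_unique)
  qed (auto simp: sets_J sets_pair_measure J'_def)
  have int_J: "(\<integral>z. u (fst z) * v (snd z) \<partial>J) = (\<integral>x. u x * (\<integral>y. v y \<partial>N x) \<partial>\<mu>)"
    if [measurable]: "u \<in> borel_measurable \<mu>" "v \<in> borel_measurable \<mu>"
      and bu: "\<And>x. x \<in> space \<mu> \<Longrightarrow> \<bar>u x\<bar> \<le> A" and bv: "\<And>x. x \<in> space \<mu> \<Longrightarrow> \<bar>v x\<bar> \<le> B"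
    for u v :: "'a \<Rightarrow> real" and A B
  proof -
    have "(\<integral>z. u (fst z) * v (snd z) \<partial>J) = (\<integral>x. (\<integral>z. u (fst z) * v (snd z) \<partial>L x) \<partial>\<mu>)"
      unfolding J_def
    proof (rule integral_bind[OF _ _ L])
      show "\<bar>u (fst z) * v (snd z)\<bar> \<le> A * B" if "z \<in> space (\<mu> \<Otimes>\<^sub>M \<mu>)" for z
        using that bu bv by (auto simp: space_pair_measure abs_mult intro!: mult_mono dest: order_trans[OF abs_ge_zero])
      show "AE x in \<mu>. emeasure (L x) (space (L x)) \<le> ennreal 1"
        using subprob_space_kernel[OF L] by (auto intro!: AE_I2 subprob_space.subprob_emeasure_le_1)
    qed (measurable, unfold_locales)
    also have "\<dots> = (\<integral>x. u x * (\<integral>y. v y \<partial>N x) \<partial>\<mu>)"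
      by (intro Bochner_Integration.integral_cong refl) (simp add: L_def integral_distr sets_N)
    finally show ?thesis .
  qed
  have "(\<integral>x. u x * (\<integral>y. v y \<partial>N x) \<partial>\<mu>) = (\<integral>z. u (fst z) * v (snd z) \<partial>J')"
    using int_J[OF u v bu bv] \<open>J = J'\<close> by simp
  also have "\<dots> = (\<integral>z. v (fst z) * u (snd z) \<partial>J)"
    by (simp add: J'_def integral_distr case_prod_beta mult.commute)
  also have "\<dots> = (\<integral>x. v x * (\<integral>y. u y \<partial>N x) \<partial>\<mu>)"
    by (rule int_J[OF v u bv bu])
  finally show ?thesis .
qed


text \<open>The family is indexed by \<open>t > 0\<close> because the doubling argument compares \<open>T t f\<close> with \<open>f\<close> itself
  instead of with its image under a kernel for time \<open>0\<close>.  The algebra of kernels \<open>prob_algebra \<mu>\<close> depends on \<open>\<mu>\<close> through its \<open>\<sigma>\<close>-algebra alone.\<close>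

locale reversible_kernels = prob_space \<mu> for \<mu> :: "'a measure" +
  fixes K :: "real \<Rightarrow> 'a \<Rightarrow> 'a measure"
  assumes kernel: "0 < t \<Longrightarrow> K t \<in> \<mu> \<rightarrow>\<^sub>M prob_algebra \<mu>"
    and chapman_kolmogorov: "0 < s \<Longrightarrow> 0 < t \<Longrightarrow> x \<in> space \<mu> \<Longrightarrow> K (s + t) x = K s x \<bind> K t"
    and detailed_balance: "0 < t \<Longrightarrow> A \<in> sets \<mu> \<Longrightarrow> B \<in> sets \<mu> \<Longrightarrow>
      (\<integral>\<^sup>+x\<in>A. emeasure (K t x) B \<partial>\<mu>) = (\<integral>\<^sup>+x\<in>B. emeasure (K t x) A \<partial>\<mu>)"
begin

abbreviation T :: "real \<Rightarrow> ('a \<Rightarrow> real) \<Rightarrow> 'a \<Rightarrow> real" where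
  "T t f x \<equiv> \<integral>y. f y \<partial>K t x"

lemma subprob_kernel: "0 < t \<Longrightarrow> K t \<in> \<mu> \<rightarrow>\<^sub>M subprob_algebra \<mu>"
  using kernel by (rule measurable_prob_algebraD)

lemma
  assumes "0 < t" "x \<in> space \<mu>"
  shows prob_space_kernel: "prob_space (K t x)"
    and space_kernel: "space (K t x) = space \<mu>"
    and sets_kernel: "sets (K t x) = sets \<mu>"
    and measurable_kernel: "measurable (K t x) N = measurable \<mu> N"
  using measurable_space[OF kernel[OF assms(1)] assms(2)]
    subprob_measurableD[OF subprob_kernel[OF assms(1)] assms(2)]
  by (auto simp: space_prob_algebra)

lemma measurable_T: "0 < t \<Longrightarrow> f \<in> borel_measurable \<mu> \<Longrightarrow> T t f \<in> borel_measurable \<mu>"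
  by (rule measurable_compose[OF subprob_kernel integral_measurable_subprob_algebra])

lemma integrable_bounded:
  fixes f :: "'a \<Rightarrow> real"
  assumes "f \<in> borel_measurable \<mu>" "\<And>y. y \<in> space \<mu> \<Longrightarrow> \<bar>f y\<bar> \<le> B"
  shows "integrable \<mu> f"
  using assms by (intro integrable_const_bound[where B = B]) auto

lemma T_bounded:
  assumes t: "0 < t" and x: "x \<in> space \<mu>"
    and f: "f \<in> borel_measurable \<mu>" and B: "\<And>y. y \<in> space \<mu> \<Longrightarrow> \<bar>f y\<bar> \<le> B"
  shows "\<bar>T t f x\<bar> \<le> B"
proof -
  interpret Kx: prob_space "K t x"
    using t x by (rule prob_space_kernel)
  have "\<bar>T t f x\<bar> \<le> (\<integral>y. \<bar>f y\<bar> \<partial>K t x)"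
    by (rule integral_abs_bound)
  also have "\<dots> \<le> (\<integral>y. B \<partial>K t x)"
    using f B t x
    by (intro integral_mono integrable_abs Kx.integrable_const_bound[where B = B and f = f] integrable_const)
      (auto simp: space_kernel measurable_kernel)
  also have "\<dots> = B"
    by (simp add: Kx.prob_space)
  finally show ?thesis .
qed

lemma T_add:
  assumes s: "0 < s" and t: "0 < t" and x: "x \<in> space \<mu>"
    and f: "f \<in> borel_measurable \<mu>" "\<And>y. y \<in> space \<mu> \<Longrightarrow> \<bar>f y\<bar> \<le> B"
  shows "T (s + t) f x = T s (T t f) x"
  unfolding chapman_kolmogorov[OF s t x]
proof (rule integral_bind[OF f])
  show "K t \<in> K s x \<rightarrow>\<^sub>M subprob_algebra \<mu>"
    using s t x by (simp add: measurable_kernel subprob_kernel)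
  show "finite_measure (K s x)"
    using prob_space_kernel[OF s x] by (simp add: prob_space_def)
  show "AE y in K s x. emeasure (K t y) (space (K t y)) \<le> ennreal 1"
    using prob_space.emeasure_space_1[OF prob_space_kernel[OF t]] s x
    by (intro AE_I2) (simp add: space_kernel)
qed

lemma T_symmetric:
  assumes "0 < t" "u \<in> borel_measurable \<mu>" "v \<in> borel_measurable \<mu>"
    and "\<And>x. x \<in> space \<mu> \<Longrightarrow> \<bar>u x\<bar> \<le> A" "\<And>x. x \<in> space \<mu> \<Longrightarrow> \<bar>v x\<bar> \<le> B"
  shows "(\<integral>x. u x * T t v x \<partial>\<mu>) = (\<integral>x. v x * T t u x \<partial>\<mu>)"
  using assms detailed_balance[OF assms(1)]
  by (intro reversible_kernel_symmetric[OF prob_space_axioms kernel]) auto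

lemma nn_integral_invariant:
  assumes t: "0 < t" and h: "h \<in> borel_measurable \<mu>"
  shows "(\<integral>\<^sup>+x. \<integral>\<^sup>+y. h y \<partial>K t x \<partial>\<mu>) = (\<integral>\<^sup>+x. h x \<partial>\<mu>)"
proof -
  have "\<mu> \<bind> K t = \<mu>"
  proof (rule measure_eqI)
    show sets: "sets (\<mu> \<bind> K t) = sets \<mu>"
      using t by (intro sets_bind) (auto simp: sets_kernel not_empty)
    fix A assume "A \<in> sets (\<mu> \<bind> K t)"
    then have A: "A \<in> sets \<mu>"
      by (simp add: sets)
    have "emeasure (\<mu> \<bind> K t) A = (\<integral>\<^sup>+x. emeasure (K t x) A \<partial>\<mu>)"
      by (rule emeasure_bind[OF not_empty subprob_kernel[OF t] A])
    also have "\<dots> = (\<integral>\<^sup>+x\<in>space \<mu>. emeasure (K t x) A \<partial>\<mu>)"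
      by (intro nn_integral_cong) simp
    also have "\<dots> = (\<integral>\<^sup>+x\<in>A. emeasure (K t x) (space \<mu>) \<partial>\<mu>)"
      by (rule detailed_balance[OF t sets.top A])
    also have "\<dots> = (\<integral>\<^sup>+x. indicator A x \<partial>\<mu>)"
      using prob_space.emeasure_space_1[OF prob_space_kernel[OF t]]
      by (intro nn_integral_cong) (simp add: space_kernel t)
    finally show "emeasure (\<mu> \<bind> K t) A = emeasure \<mu> A"
      using A by simp
  qed
  then show ?thesis
    using nn_integral_bind[OF h subprob_kernel[OF t]] by simp
qed

text \<open>An integrable \<open>f\<close> need not be integrable against every \<open>K t x\<close>, and \<open>T t f x\<close> is \<open>0\<close> at the bad
  points.  By invariance of \<open>\<mu>\<close> these points form a null set.\<close>

lemma AE_integrable_kernel: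
  fixes f :: "'a \<Rightarrow> real"
  assumes t: "0 < t" and f: "integrable \<mu> f"
  shows "AE x in \<mu>. integrable (K t x) f"
proof -
  have [measurable]: "f \<in> borel_measurable \<mu>"
    using f by simp
  have "(\<integral>\<^sup>+x. \<integral>\<^sup>+y. norm (f y) \<partial>K t x \<partial>\<mu>) \<noteq> \<infinity>"
    using f by (subst nn_integral_invariant[OF t]) (auto simp: integrable_iff_bounded)
  then have "AE x in \<mu>. (\<integral>\<^sup>+y. norm (f y) \<partial>K t x) \<noteq> \<infinity>"
    by (intro nn_integral_PInf_AE
      measurable_compose[OF subprob_kernel[OF t] nn_integral_measurable_subprob_algebra]) auto
  with AE_space show ?thesis
  proof eventually_elim
    case (elim x)
    then show ?case
      using t by (simp add: integrable_iff_bounded measurable_kernel less_top)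
  qed
qed

text \<open>The identity \<open>\<parallel>S\<^sub>t f\<parallel>\<^sup>2 = \<langle>S\<^sub>t f, S\<^sub>t f\<rangle> = \<langle>f, S\<^sub>2\<^sub>t f\<rangle>\<close>, by symmetry and the semigroup law.\<close>

lemma centred_norm_eq:
  fixes f :: "'a \<Rightarrow> real"
  assumes t: "0 < t" and f: "f \<in> borel_measurable \<mu>" and B: "\<And>y. y \<in> space \<mu> \<Longrightarrow> \<bar>f y\<bar> \<le> B"
  defines "m \<equiv> \<integral>y. f y \<partial>\<mu>"
  shows "(\<integral>x. (T t f x - m)\<^sup>2 \<partial>\<mu>) = (\<integral>x. f x * (T (2 * t) f x - m) \<partial>\<mu>)"
proof -
  have Tf: "T t f \<in> borel_measurable \<mu>" "\<And>x. x \<in> space \<mu> \<Longrightarrow> \<bar>T t f x\<bar> \<le> B"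
    using measurable_T[OF t f] T_bounded[OF t _ f B] by auto
  have [measurable]: "T (2 * t) f \<in> borel_measurable \<mu>" "f \<in> borel_measurable \<mu>" "T t f \<in> borel_measurable \<mu>"
    using t f by (auto intro: measurable_T)
  have T2: "\<bar>T (2 * t) f x\<bar> \<le> B" if "x \<in> space \<mu>" for x
    using t that by (intro T_bounded f B) auto
  have prod: "\<bar>u * v\<bar> \<le> B * B" if "\<bar>u\<bar> \<le> B" "\<bar>v\<bar> \<le> B" for u v :: real
    using that by (auto simp: abs_mult intro!: mult_mono dest: order_trans[OF abs_ge_zero])
  have int: "integrable \<mu> (T t f)" "integrable \<mu> f"
    using integrable_bounded[OF Tf] integrable_bounded[OF f B] by auto
  have int2: "integrable \<mu> (\<lambda>x. T t f x * T t f x)" "integrable \<mu> (\<lambda>x. f x * T (2 * t) f x)"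
    using Tf B T2 by (auto intro!: integrable_bounded[where B = "B * B"] prod)
  have "(\<integral>x. 1 * T t f x \<partial>\<mu>) = (\<integral>x. f x * T t (\<lambda>_. 1) x \<partial>\<mu>)"
    using f B by (intro T_symmetric[OF t, where A = 1 and B = B]) auto
  also have "\<dots> = m"
    unfolding m_def
  proof (intro Bochner_Integration.integral_cong refl)
    show "f x * T t (\<lambda>_. 1) x = f x" if "x \<in> space \<mu>" for x
      using prob_space.prob_space[OF prob_space_kernel[OF t that]] by simp
  qed
  finally have mean: "(\<integral>x. T t f x \<partial>\<mu>) = m"
    by simp
  have "(\<integral>x. T t f x * T t f x \<partial>\<mu>) = (\<integral>x. f x * T t (T t f) x \<partial>\<mu>)"
    by (rule T_symmetric[OF t Tf(1) f Tf(2) B])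
  also have "\<dots> = (\<integral>x. f x * T (2 * t) f x \<partial>\<mu>)"
    by (intro Bochner_Integration.integral_cong refl)
      (simp only: mult_2 T_add[OF t t _ f B])
  finally have sq: "(\<integral>x. T t f x * T t f x \<partial>\<mu>) = (\<integral>x. f x * T (2 * t) f x \<partial>\<mu>)" .
  have "(\<integral>x. (T t f x - m)\<^sup>2 \<partial>\<mu>) = (\<integral>x. T t f x * T t f x - 2 * m * T t f x + m\<^sup>2 \<partial>\<mu>)"
    by (intro Bochner_Integration.integral_cong refl) (simp add: power2_eq_square algebra_simps)
  also have "\<dots> = (\<integral>x. f x * T (2 * t) f x \<partial>\<mu>) - m * m"
    using int int2 by (simp add: mean sq prob_space power2_eq_square)
  also have "\<dots> = (\<integral>x. f x * T (2 * t) f x - m * f x \<partial>\<mu>)"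
    using int int2 by (simp add: m_def)
  also have "\<dots> = (\<integral>x. f x * (T (2 * t) f x - m) \<partial>\<mu>)"
    by (intro Bochner_Integration.integral_cong refl) (simp add: algebra_simps)
  finally show ?thesis .
qed

section \<open>Decay in \<open>L\<^sup>2\<close>\<close>

text \<open>A bound on \<open>\<langle>f, S\<^sub>t f\<rangle>\<close> with an arbitrary constant \<open>C\<close> already gives the sharp bound on \<open>\<parallel>S\<^sub>t f\<parallel>\<close>,
  because \<open>b(t) = \<parallel>S\<^sub>t f\<parallel>\<^sup>2 / \<parallel>f\<parallel>\<^sup>2\<close> satisfies \<open>b(t)\<^sup>2 \<le> b(2t)\<close>.\<close>

lemma decay_of_bounded:
  fixes f :: "'a \<Rightarrow> real"
  assumes f: "f \<in> borel_measurable \<mu>" and B: "\<And>y. y \<in> space \<mu> \<Longrightarrow> \<bar>f y\<bar> \<le> B"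
  defines "m \<equiv> \<integral>y. f y \<partial>\<mu>"
  assumes weak: "\<And>t. 0 < t \<Longrightarrow> (\<integral>x. f x * (T t f x - m) \<partial>\<mu>) \<le> C * exp (\<rho> * t)"
    and t: "0 < t"
  shows "(\<integral>x. (T t f x - m)\<^sup>2 \<partial>\<mu>) \<le> (exp (\<rho> * t))\<^sup>2 * (\<integral>x. (f x)\<^sup>2 \<partial>\<mu>)"
proof -
  define a where "a t = (\<integral>x. (T t f x - m)\<^sup>2 \<partial>\<mu>)" for t
  define N where "N = (\<integral>x. (f x)\<^sup>2 \<partial>\<mu>)"
  have a_eq: "a t = (\<integral>x. f x * (T (2 * t) f x - m) \<partial>\<mu>)" if "0 < t" for t
    unfolding a_def m_def using centred_norm_eq[OF that f B] .
  have doubling: "(a t)\<^sup>2 \<le> N * a (2 * t)" if "0 < t" for t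
  proof -
    have "0 < 2 * t"
      using that by simp
    note T2 = measurable_T[OF this f] T_bounded[OF this _ f B]
    have "(\<integral>x. f x * (T (2 * t) f x - m) \<partial>\<mu>)\<^sup>2 \<le> (\<integral>x. (f x)\<^sup>2 \<partial>\<mu>) * (\<integral>x. (T (2 * t) f x - m)\<^sup>2 \<partial>\<mu>)"
    proof (rule integral_Cauchy_Schwarz_bounded[OF f _ B])
      show "\<bar>T (2 * t) f x - m\<bar> \<le> B + \<bar>m\<bar>" if "x \<in> space \<mu>" for x
        using T2(2)[OF that] by linarith
    qed (use T2(1) in measurable)
    then show ?thesis
      unfolding N_def a_eq[OF that] by (simp add: a_def)
  qed
  show ?thesis
  proof (cases "N = 0")
    case True
    then have "a t = 0"
      using doubling[OF t] by simp
    then show ?thesis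
      by (simp add: a_def)
  next
    case False
    then have N: "0 < N"
      by (simp add: N_def order.not_eq_order_implies_strict)
    have "a t / N \<le> exp ((2 * \<rho>) * t)"
    proof (rule exponential_bound_by_doubling[OF _ _ _ t])
      fix t :: real assume t: "0 < t"
      show "0 \<le> a t / N"
        using N by (simp add: a_def)
      show "(a t / N)\<^sup>2 \<le> a (2 * t) / N"
        using doubling[OF t] N by (simp add: power2_eq_square field_simps)
      show "a t / N \<le> C / N * exp ((2 * \<rho>) * t)"
        using weak[of "2 * t"] a_eq[OF t] t N by (simp add: field_simps)
    qed
    then show ?thesis
      using N by (simp add: a_def N_def field_simps power2_eq_square exp_add[symmetric])
  qed
qed

text \<open>Along the approximations \<open>S\<^sub>t\<close> converges almost everywhere, by dominated convergence under almost
  every \<open>K t x\<close>; Fatou's lemma then yields both square integrability and the bound.  Passing to the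
  limit pointwise avoids the discussion of \<open>T t\<close> as a bounded operator on classes of functions.\<close>

lemma decay_by_approximation:
  fixes f :: "'a \<Rightarrow> real" and f' :: "nat \<Rightarrow> 'a \<Rightarrow> real"
  assumes t: "0 < t" and f: "f \<in> L2 \<mu>"
    and f': "\<And>n. f' n \<in> borel_measurable \<mu>"
    and lim: "\<And>x. x \<in> space \<mu> \<Longrightarrow> (\<lambda>n. f' n x) \<longlonglongrightarrow> f x"
    and dom: "\<And>n x. x \<in> space \<mu> \<Longrightarrow> \<bar>f' n x\<bar> \<le> \<bar>f x\<bar>"
    and bdd: "\<And>n x. x \<in> space \<mu> \<Longrightarrow> \<bar>f' n x\<bar> \<le> real n"
    and c: "0 \<le> c"
    and bound: "\<And>n. (\<integral>x. (T t (f' n) x - (\<integral>y. f' n y \<partial>\<mu>))\<^sup>2 \<partial>\<mu>) \<le> c\<^sup>2 * (\<integral>x. (f' n x)\<^sup>2 \<partial>\<mu>)"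
  shows "(\<lambda>x. T t f x - (\<integral>y. f y \<partial>\<mu>)) \<in> L2 \<mu>"
    and "L2_norm \<mu> (\<lambda>x. T t f x - (\<integral>y. f y \<partial>\<mu>)) \<le> c * L2_norm \<mu> f"
proof -
  have fm[measurable]: "f \<in> borel_measurable \<mu>" and f2: "integrable \<mu> (\<lambda>x. (f x)\<^sup>2)"
    using f by (auto simp: L2_def)
  have f1: "integrable \<mu> f"
    using f2 by (rule square_integrable_imp_integrable[OF fm])
  define S where "S h x = T t h x - (\<integral>y. h y \<partial>\<mu>)" for h x
  have Sm[measurable]: "S h \<in> borel_measurable \<mu>" if "h \<in> borel_measurable \<mu>" for h
    using measurable_T[OF t that] unfolding S_def by measurable
  have mean_lim: "(\<lambda>n. \<integral>y. f' n y \<partial>\<mu>) \<longlonglongrightarrow> (\<integral>y. f y \<partial>\<mu>)"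
    using f' f1 lim dom by (intro integral_dominated_convergence[where w = "\<lambda>x. \<bar>f x\<bar>"]) auto
  have S_lim: "AE x in \<mu>. (\<lambda>n. S (f' n) x) \<longlonglongrightarrow> S f x"
    using AE_integrable_kernel[OF t f1] AE_space
  proof eventually_elim
    case (elim x)
    have "(\<lambda>n. T t (f' n) x) \<longlonglongrightarrow> T t f x"
      using elim f' lim dom t
      by (intro integral_dominated_convergence[where w = "\<lambda>x. \<bar>f x\<bar>"])
        (auto simp: measurable_kernel space_kernel)
    then show ?case
      unfolding S_def by (intro tendsto_diff mean_lim)
  qed
  have bound_n: "(\<integral>\<^sup>+x. ennreal ((S (f' n) x)\<^sup>2) \<partial>\<mu>) \<le> ennreal (c\<^sup>2 * (\<integral>x. (f x)\<^sup>2 \<partial>\<mu>))" for n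
  proof -
    have "\<bar>S (f' n) x\<bar> \<le> real n + \<bar>\<integral>y. f' n y \<partial>\<mu>\<bar>" if "x \<in> space \<mu>" for x
      using T_bounded[OF t that f' bdd, of n] unfolding S_def by linarith
    then have "\<bar>(S (f' n) x)\<^sup>2\<bar> \<le> (real n + \<bar>\<integral>y. f' n y \<partial>\<mu>\<bar>)\<^sup>2" if "x \<in> space \<mu>" for x
      using that by (simp add: abs_le_square_iff[symmetric])
    then have "integrable \<mu> (\<lambda>x. (S (f' n) x)\<^sup>2)"
      using f' by (intro integrable_bounded) auto
    then have "(\<integral>\<^sup>+x. ennreal ((S (f' n) x)\<^sup>2) \<partial>\<mu>) = ennreal (\<integral>x. (S (f' n) x)\<^sup>2 \<partial>\<mu>)"
      by (intro nn_integral_eq_integral) auto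
    also have "(\<integral>x. (S (f' n) x)\<^sup>2 \<partial>\<mu>) \<le> c\<^sup>2 * (\<integral>x. (f' n x)\<^sup>2 \<partial>\<mu>)"
      using bound[of n] by (simp add: S_def)
    also have "\<dots> \<le> c\<^sup>2 * (\<integral>x. (f x)\<^sup>2 \<partial>\<mu>)"
    proof (intro mult_left_mono integral_mono)
      show "integrable \<mu> (\<lambda>x. (f' n x)\<^sup>2)"
        using f' dom by (intro Bochner_Integration.integrable_bound[OF f2]) (auto simp: abs_le_square_iff[symmetric])
    qed (use f2 dom in \<open>auto simp: abs_le_square_iff[symmetric]\<close>)
    finally show ?thesis
      by (simp add: ennreal_leI)
  qed
  have "(\<integral>\<^sup>+x. ennreal ((S f x)\<^sup>2) \<partial>\<mu>) = (\<integral>\<^sup>+x. liminf (\<lambda>n. ennreal ((S (f' n) x)\<^sup>2)) \<partial>\<mu>)"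
  proof (rule nn_integral_cong_AE)
    show "AE x in \<mu>. ennreal ((S f x)\<^sup>2) = liminf (\<lambda>n. ennreal ((S (f' n) x)\<^sup>2))"
      using S_lim
    proof eventually_elim
      case (elim x)
      then have "(\<lambda>n. ennreal ((S (f' n) x)\<^sup>2)) \<longlonglongrightarrow> ennreal ((S f x)\<^sup>2)"
        by (intro tendsto_ennrealI tendsto_power)
      then show ?case
        by (intro lim_imp_Liminf[symmetric]) auto
    qed
  qed
  also have "\<dots> \<le> liminf (\<lambda>n. \<integral>\<^sup>+x. ennreal ((S (f' n) x)\<^sup>2) \<partial>\<mu>)"
    using f' by (intro nn_integral_liminf) measurable
  also have "\<dots> \<le> liminf (\<lambda>n::nat. ennreal (c\<^sup>2 * (\<integral>x. (f x)\<^sup>2 \<partial>\<mu>)))"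
    by (intro Liminf_mono always_eventually allI bound_n)
  finally have fatou: "(\<integral>\<^sup>+x. ennreal ((S f x)\<^sup>2) \<partial>\<mu>) \<le> ennreal (c\<^sup>2 * (\<integral>x. (f x)\<^sup>2 \<partial>\<mu>))"
    unfolding Liminf_const[OF sequentially_bot] .
  then have S2: "integrable \<mu> (\<lambda>x. (S f x)\<^sup>2)"
    by (intro integrableI_bounded) (auto intro: le_less_trans simp: abs_square_le_1)
  then show "(\<lambda>x. T t f x - (\<integral>y. f y \<partial>\<mu>)) \<in> L2 \<mu>"
    using Sm[OF fm] by (simp add: L2_def S_def[abs_def])
  have "(\<integral>x. (S f x)\<^sup>2 \<partial>\<mu>) \<le> c\<^sup>2 * (\<integral>x. (f x)\<^sup>2 \<partial>\<mu>)"
    using fatou nn_integral_eq_integral[OF S2] by (simp add: ennreal_le_iff)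
  then have "sqrt (\<integral>x. (S f x)\<^sup>2 \<partial>\<mu>) \<le> sqrt (c\<^sup>2 * (\<integral>x. (f x)\<^sup>2 \<partial>\<mu>))"
    by (rule real_sqrt_le_mono)
  then show "L2_norm \<mu> (\<lambda>x. T t f x - (\<integral>y. f y \<partial>\<mu>)) \<le> c * L2_norm \<mu> f"
    using c by (simp add: L2_norm_def S_def real_sqrt_mult)
qed

text \<open>The sets \<open>A n\<close> stand for the compact balls on which \<open>g\<close> is integrable.  The functions \<open>f' n\<close> in the
  proof are truncated both in the domain, to make \<open>\<integral>\<^sub>A g d\<mu>\<close> finite, and in the values, to make the
  total-variation bound \<open>decay\<close> applicable.\<close>

lemma L2_decay:
  fixes f g :: "'a \<Rightarrow> real" and A :: "nat \<Rightarrow> 'a set"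
  assumes A: "\<And>n. A n \<in> sets \<mu>" "incseq A" "(\<Union>n. A n) = space \<mu>"
    and g: "\<And>n. set_integrable \<mu> (A n) g"
    and decay: "\<And>t x h B. 0 < t \<Longrightarrow> x \<in> space \<mu> \<Longrightarrow> h \<in> borel_measurable \<mu> \<Longrightarrow>
      (\<And>y. y \<in> space \<mu> \<Longrightarrow> \<bar>h y\<bar> \<le> B) \<Longrightarrow> \<bar>T t h x - (\<integral>y. h y \<partial>\<mu>)\<bar> \<le> B * (g x * exp (\<rho> * t))"
    and t: "0 < t" and f: "f \<in> L2 \<mu>"
  shows "(\<lambda>x. T t f x - (\<integral>y. f y \<partial>\<mu>)) \<in> L2 \<mu>"
    and "L2_norm \<mu> (\<lambda>x. T t f x - (\<integral>y. f y \<partial>\<mu>)) \<le> exp (\<rho> * t) * L2_norm \<mu> f"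
proof -
  have [measurable]: "f \<in> borel_measurable \<mu>" "A n \<in> sets \<mu>" for n
    using f A by (auto simp: L2_def)
  define f' where "f' n x = indicator (A n) x * (if \<bar>f x\<bar> \<le> real n then f x else 0)" for n x
  have f'm[measurable]: "f' n \<in> borel_measurable \<mu>" for n
    unfolding f'_def by measurable
  have bdd: "\<bar>f' n x\<bar> \<le> real n" for n x
    by (simp add: f'_def indicator_def)
  have bound: "(\<integral>x. (T s (f' n) x - (\<integral>y. f' n y \<partial>\<mu>))\<^sup>2 \<partial>\<mu>) \<le> (exp (\<rho> * s))\<^sup>2 * (\<integral>x. (f' n x)\<^sup>2 \<partial>\<mu>)"
    if s: "0 < s" for n s
  proof (rule decay_of_bounded[OF f'm bdd _ s])
    fix t :: real assume t: "0 < t"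
    have [measurable]: "T t (f' n) \<in> borel_measurable \<mu>"
      using t by (rule measurable_T) measurable
    define C where "C = (real n)\<^sup>2 * (\<integral>x\<in>A n. g x \<partial>\<mu>)"
    have pw: "\<bar>f' n x * (T t (f' n) x - (\<integral>y. f' n y \<partial>\<mu>))\<bar>
        \<le> (real n)\<^sup>2 * exp (\<rho> * t) * (indicator (A n) x *\<^sub>R g x)" if x: "x \<in> space \<mu>" for x
    proof (cases "x \<in> A n")
      case True
      have "\<bar>f' n x * (T t (f' n) x - (\<integral>y. f' n y \<partial>\<mu>))\<bar> \<le> real n * (real n * (g x * exp (\<rho> * t)))"
        unfolding abs_mult by (intro mult_mono bdd decay[OF t x f'm bdd]) auto
      with True show ?thesis
        by (simp add: power2_eq_square mult_ac)
    qed (simp add: f'_def)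
    have gi: "integrable \<mu> (\<lambda>x. (real n)\<^sup>2 * exp (\<rho> * t) * (indicator (A n) x *\<^sub>R g x))"
      using g[of n] by (auto simp: set_integrable_def intro!: integrable_mult_right)
    have "(\<integral>x. f' n x * (T t (f' n) x - (\<integral>y. f' n y \<partial>\<mu>)) \<partial>\<mu>)
        \<le> (\<integral>x. (real n)\<^sup>2 * exp (\<rho> * t) * (indicator (A n) x *\<^sub>R g x) \<partial>\<mu>)"
    proof (rule integral_mono[OF _ gi])
      show "integrable \<mu> (\<lambda>x. f' n x * (T t (f' n) x - (\<integral>y. f' n y \<partial>\<mu>)))"
        using pw by (intro Bochner_Integration.integrable_bound[OF gi] AE_I2) (auto intro: order_trans[OF _ abs_ge_self])
    qed (use pw abs_ge_self order_trans in blast)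
    also have "\<dots> = C * exp (\<rho> * t)"
      by (simp add: C_def set_lebesgue_integral_def)
    finally show "(\<integral>x. f' n x * (T t (f' n) x - (\<integral>y. f' n y \<partial>\<mu>)) \<partial>\<mu>) \<le> C * exp (\<rho> * t)" .
  qed
  have lim: "(\<lambda>n. f' n x) \<longlonglongrightarrow> f x" if "x \<in> space \<mu>" for x
  proof (rule tendsto_eventually)
    obtain k where k: "x \<in> A k"
      using \<open>x \<in> space \<mu>\<close> A(3) by auto
    have "f' n x = f x" if "n \<ge> max k (nat \<lceil>\<bar>f x\<bar>\<rceil>)" for n
    proof -
      have "x \<in> A n"
        using k that incseqD[OF A(2), of k n] by auto
      moreover have "\<bar>f x\<bar> \<le> real n"
        using that by linarith
      ultimately show ?thesis
        by (simp add: f'_def)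
    qed
    then show "\<forall>\<^sub>F n in sequentially. f' n x = f x"
      unfolding eventually_sequentially by blast
  qed
  have dom: "\<bar>f' n x\<bar> \<le> \<bar>f x\<bar>" for n x
    by (simp add: f'_def indicator_def)
  show "(\<lambda>x. T t f x - (\<integral>y. f y \<partial>\<mu>)) \<in> L2 \<mu>"
    "L2_norm \<mu> (\<lambda>x. T t f x - (\<integral>y. f y \<partial>\<mu>)) \<le> exp (\<rho> * t) * L2_norm \<mu> f"
    using decay_by_approximation[OF t f f'm lim dom bdd _ bound[OF t]] by auto
qed

end


section \<open>The diffusion and its equilibrium\<close>

text \<open>The Chapman-Kolmogorov equation is the expectation of the Markov property at time \<open>s\<close>.\<close>

lemma (in diffusion) transition_kernel_add:
  assumes s: "0 \<le> s" and t: "0 \<le> t"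
  shows "transition_kernel P X (s + t) x = transition_kernel P X s x \<bind> transition_kernel P X t"
proof (rule measure_eqI)
  interpret weak_solution "P x" F W b \<sigma> x X
    by (rule solution)
  interpret S: finite_measure_subalgebra "P x" "F s"
    using subalgebra_F[OF s] by unfold_locales
  have X: "X r \<in> borel_measurable (P x)" if "0 \<le> r" for r
    using measurable_from_subalg[OF subalgebra_F adapted_X] that by auto
  have Xs[measurable]: "X s \<in> borel_measurable (P x)" and Xst[measurable]: "X (s + t) \<in> borel_measurable (P x)"
    using s t by (auto intro: X)
  have Kt: "transition_kernel P X t \<in> borel \<rightarrow>\<^sub>M subprob_algebra borel"
    using kernel[OF t] by (rule measurable_prob_algebraD)
  have Kt': "transition_kernel P X t \<in> transition_kernel P X s x \<rightarrow>\<^sub>M subprob_algebra borel"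
    using Kt by (simp add: transition_kernel_def)
  have ne: "space (transition_kernel P X s x) \<noteq> {}"
    by (simp add: transition_kernel_def)
  show "sets (transition_kernel P X (s + t) x) = sets (transition_kernel P X s x \<bind> transition_kernel P X t)"
    using ne by (subst sets_bind[where N = borel]) (auto simp: transition_kernel_def)
  fix A assume "A \<in> sets (transition_kernel P X (s + t) x)"
  then have A[measurable]: "A \<in> sets borel"
    by (simp add: transition_kernel_def)
  have prob_Kt: "prob_space (transition_kernel P X t y)" for y
    using measurable_space[OF kernel[OF t], of y] by (simp add: space_prob_algebra)
  define q where "q y = measure (transition_kernel P X t y) A" for y
  have qm[measurable]: "q \<in> borel_measurable borel"
    unfolding q_def by (rule measurable_compose[OF Kt measurable_measure_subprob_algebra[OF A]])
  have q: "0 \<le> q y" "q y \<le> 1" for y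
    using prob_space.prob_le_1[OF prob_Kt] by (auto simp: q_def)
  have ind: "integrable (P x) (\<lambda>\<omega>. indicator A (X (s + t) \<omega>) :: real)"
    by (intro integrable_const_bound[where B = 1]) auto
  have "measure (transition_kernel P X (s + t) x) A = (\<integral>\<omega>. indicator A (X (s + t) \<omega>) \<partial>P x)"
    by (subst Bochner_Integration.integral_distr[OF Xst, where f = "indicator A :: _ \<Rightarrow> real", symmetric])
      (simp_all add: transition_kernel_def)
  also have "\<dots> = (\<integral>\<omega>. real_cond_exp (P x) (F s) (\<lambda>\<omega>'. indicator A (X (s + t) \<omega>')) \<omega> \<partial>P x)"
    by (rule S.real_cond_exp_int(2)[OF ind, symmetric])
  also have "\<dots> = (\<integral>\<omega>. q (X s \<omega>) \<partial>P x)"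
    using markov[OF s t A, of x] unfolding q_def[symmetric]
    by (intro integral_cong_AE) auto
  finally have "emeasure (transition_kernel P X (s + t) x) A = ennreal (\<integral>\<omega>. q (X s \<omega>) \<partial>P x)"
    using prob_space.finite_measure[OF prob_space_distr[OF Xst]]
    by (simp add: finite_measure.emeasure_eq_measure transition_kernel_def)
  also have "\<dots> = (\<integral>\<^sup>+\<omega>. ennreal (q (X s \<omega>)) \<partial>P x)"
    using q by (intro nn_integral_eq_integral[symmetric] integrable_const_bound[where B = 1]) auto
  also have "\<dots> = (\<integral>\<^sup>+y. ennreal (q y) \<partial>transition_kernel P X s x)"
    by (simp add: transition_kernel_def nn_integral_distr)
  also have "\<dots> = (\<integral>\<^sup>+y. emeasure (transition_kernel P X t y) A \<partial>transition_kernel P X s x)"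
    using prob_space.finite_measure[OF prob_Kt]
    by (simp add: q_def finite_measure.emeasure_eq_measure)
  also have "\<dots> = emeasure (transition_kernel P X s x \<bind> transition_kernel P X t) A"
    by (rule emeasure_bind[OF ne Kt' A, symmetric])
  finally show "emeasure (transition_kernel P X (s + t) x) A
    = emeasure (transition_kernel P X s x \<bind> transition_kernel P X t) A" .
qed

lemma gibbs_density:
  fixes U :: "real^'n \<Rightarrow> real"
  assumes U: "U \<in> borel_measurable borel" and int: "integrable lborel (\<lambda>x. exp (- U x))"
  shows gibbs_density_pos: "0 < gibbs_density U x"
    and measurable_gibbs_density: "gibbs_density U \<in> borel_measurable borel"
    and prob_space_gibbs_measure: "prob_space (gibbs_measure U)"
proof -
  have pos: "0 < (\<integral>y. exp (- U y) \<partial>lborel)"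
  proof -
    have "\<not> (AE y in lborel. exp (- U y) = 0)"
      using AE_iff_null_sets[of UNIV "lborel :: (real^'n) measure"] by (simp add: null_sets_def)
    then have "(\<integral>y. exp (- U y) \<partial>lborel) \<noteq> 0"
      using integral_nonneg_eq_0_iff_AE[OF int] by simp
    then show ?thesis
      by (simp add: order.not_eq_order_implies_strict)
  qed
  show "0 < gibbs_density U x"
    using pos by (simp add: gibbs_density_def)
  show [measurable]: "gibbs_density U \<in> borel_measurable borel"
    using U unfolding gibbs_density_def by measurable
  have "(\<integral>\<^sup>+x. ennreal (gibbs_density U x) \<partial>lborel) = ennreal (\<integral>x. gibbs_density U x \<partial>lborel)"
    using pos int unfolding gibbs_density_def by (intro nn_integral_eq_integral) auto
  also have "(\<integral>x. gibbs_density U x \<partial>lborel) = 1"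
    using pos unfolding gibbs_density_def by simp
  finally show "prob_space (gibbs_measure U)"
    by (intro prob_spaceI) (simp add: gibbs_measure_def emeasure_density)
qed

text \<open>The quotient \<open>q / gibbs_density U\<close> is the density of the law of \<open>Y\<close> relative to \<open>\<pi>\<close>, so the
  difference of the means is the integral of \<open>(q / gibbs_density U - 1) h\<close> against \<open>\<pi>\<close>.\<close>

lemma integral_diff_le_total_variation:
  fixes U :: "real^'n \<Rightarrow> real" and q :: "real^'n \<Rightarrow> real"
  assumes U: "U \<in> borel_measurable borel" and int: "integrable lborel (\<lambda>x. exp (- U x))"
    and q: "\<And>y. 0 \<le> q y" and Y: "distributed M lborel Y (\<lambda>y. ennreal (q y))" and M: "prob_space M"
    and h[measurable]: "h \<in> borel_measurable borel" and B: "\<And>y. \<bar>h y\<bar> \<le> B"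
  shows "\<bar>(\<integral>\<omega>. h (Y \<omega>) \<partial>M) - (\<integral>y. h y \<partial>gibbs_measure U)\<bar>
    \<le> B * (\<integral>y. \<bar>q y / gibbs_density U y - 1\<bar> \<partial>gibbs_measure U)"
proof -
  let ?\<pi> = "gibbs_measure U" and ?\<gamma> = "gibbs_density U"
  interpret pi: prob_space ?\<pi>
    using U int by (rule prob_space_gibbs_measure)
  interpret M: prob_space M
    by (rule M)
  note pos = gibbs_density_pos[OF U int]
  have [measurable]: "?\<gamma> \<in> borel_measurable borel"
    using U int by (rule measurable_gibbs_density)
  have [measurable]: "q \<in> borel_measurable borel"
    using distributed_real_measurable[OF _ Y] q by simp
  have [measurable_cong]: "sets ?\<pi> = sets borel"
    by (simp add: gibbs_measure_def)
  have hq: "integrable ?\<pi> (\<lambda>y. q y / ?\<gamma> y * k y)" "(\<integral>y. q y / ?\<gamma> y * k y \<partial>?\<pi>) = (\<integral>\<omega>. k (Y \<omega>) \<partial>M)"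
    if [measurable]: "k \<in> borel_measurable borel" and C: "\<And>y. \<bar>k y\<bar> \<le> C" for k :: "real^'n \<Rightarrow> real" and C
  proof -
    \<comment> \<open>Passing from \<open>\<pi>\<close> to Lebesgue measure multiplies by the Gibbs density, which vanishes nowhere.\<close>
    have cancel: "?\<gamma> y * (q y / ?\<gamma> y * k y) = q y * k y" for y
      using pos[of y] by simp
    have [measurable]: "Y \<in> borel_measurable M"
      using distributed_measurable[OF Y] by simp
    have "integrable M (\<lambda>\<omega>. k (Y \<omega>))"
      using C by (intro M.integrable_const_bound[where B = C]) auto
    then have "integrable lborel (\<lambda>y. q y * k y)"
      by (subst distributed_integrable[OF Y]) (auto simp: q)
    then show "integrable ?\<pi> (\<lambda>y. q y / ?\<gamma> y * k y)"
      unfolding gibbs_measure_def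
      by (subst integrable_real_density) (auto simp: cancel less_imp_le[OF pos] simp del: times_divide_eq_left times_divide_eq_right)
    have "(\<integral>y. q y / ?\<gamma> y * k y \<partial>?\<pi>) = (\<integral>y. q y * k y \<partial>lborel)"
      unfolding gibbs_measure_def
      by (subst integral_real_density) (auto simp: cancel less_imp_le[OF pos] simp del: times_divide_eq_left times_divide_eq_right)
    also have "\<dots> = (\<integral>\<omega>. k (Y \<omega>) \<partial>M)"
      by (rule distributed_integral[OF Y]) (auto simp: q)
    finally show "(\<integral>y. q y / ?\<gamma> y * k y \<partial>?\<pi>) = (\<integral>\<omega>. k (Y \<omega>) \<partial>M)" .
  qed
  have hi: "integrable ?\<pi> h"
    using B by (intro pi.integrable_const_bound[where B = B]) auto
  have qi: "integrable ?\<pi> (\<lambda>y. q y / ?\<gamma> y)"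
    using hq(1)[of "\<lambda>_. 1" 1] by simp
  have "(\<integral>\<omega>. h (Y \<omega>) \<partial>M) - (\<integral>y. h y \<partial>?\<pi>) = (\<integral>y. q y / ?\<gamma> y * h y - h y \<partial>?\<pi>)"
    using hq[OF h B] hi by simp
  also have "\<bar>\<dots>\<bar> \<le> (\<integral>y. \<bar>q y / ?\<gamma> y * h y - h y\<bar> \<partial>?\<pi>)"
    by (rule integral_abs_bound)
  also have "\<dots> \<le> (\<integral>y. B * \<bar>q y / ?\<gamma> y - 1\<bar> \<partial>?\<pi>)"
  proof (rule integral_mono)
    show "\<bar>q y / ?\<gamma> y * h y - h y\<bar> \<le> B * \<bar>q y / ?\<gamma> y - 1\<bar>" for y
    proof -
      have "\<bar>q y / ?\<gamma> y * h y - h y\<bar> = \<bar>h y\<bar> * \<bar>q y / ?\<gamma> y - 1\<bar>"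
        by (simp add: abs_mult[symmetric] algebra_simps)
      then show ?thesis
        using B by (simp add: mult_right_mono)
    qed
  qed (use hq(1)[OF h B] hi qi in auto)
  also have "\<dots> = B * (\<integral>y. \<bar>q y / ?\<gamma> y - 1\<bar> \<partial>?\<pi>)"
    by simp
  finally show ?thesis .
qed

theorem theorem5:
  fixes U :: "real^'n \<Rightarrow> real" and DU :: "real^'n \<Rightarrow> real^'n" and l \<rho> :: real
    and P :: "real^'n \<Rightarrow> 'w measure" and F :: "real \<Rightarrow> 'w measure"
    and W X :: "real \<Rightarrow> 'w \<Rightarrow> real^'n" and p :: "real \<Rightarrow> real^'n \<Rightarrow> real^'n \<Rightarrow> real"
  defines "\<pi> \<equiv> gibbs_measure U"
  assumes "U \<in> borel_measurable borel"
    and "integrable lborel (\<lambda>x. exp (- U x))"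
    and "weak_gradient U DU"
    and "integrable \<pi> DU"
    and "l > real CARD('n)" and "locally_Lp \<pi> l DU"
    and "diffusion (\<lambda>x. - DU x) (sqrt 2) P F W X"
    and "reversible \<pi> P X"
    and "transition_density P X p"
    and "\<exists>g :: real^'n \<Rightarrow> real. locally_Lp \<pi> 1 g \<and>
      (\<forall>x. \<forall>t>0. (\<integral>y. \<bar>p t x y / gibbs_density U y - 1\<bar> \<partial>\<pi>) \<le> g x * exp (\<rho> * t))"
  shows "\<forall>t>0. L2_opnorm \<pi> (\<lambda>f x. markov_semigroup P X t f x - (\<integral>y. f y \<partial>\<pi>)) \<le> ennreal (exp (\<rho> * t))"
proof (intro allI impI)
  fix t :: real assume t: "0 < t"
  note U = assms(2,3) and reversible = assms(9)
  interpret D: diffusion "\<lambda>x. - DU x" "sqrt 2" P F W X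
    by fact
  interpret \<pi>: prob_space \<pi>
    unfolding \<pi>_def using U by (rule prob_space_gibbs_measure)
  have sets_\<pi>[measurable_cong]: "sets \<pi> = sets borel" and space_\<pi>: "space \<pi> = UNIV"
    by (simp_all add: \<pi>_def gibbs_measure_def)
  interpret reversible_kernels \<pi> "transition_kernel P X"
  proof
    show "transition_kernel P X s \<in> \<pi> \<rightarrow>\<^sub>M prob_algebra \<pi>" if "0 < s" for s
      using D.kernel[of s] that subprob_algebra_cong[OF sets_\<pi>]
    by (simp add: prob_algebra_def sets_\<pi> cong: measurable_cong_sets)
    show "transition_kernel P X (r + s) x = transition_kernel P X r x \<bind> transition_kernel P X s"
      if "0 < r" "0 < s" for r s x
      using that by (intro D.transition_kernel_add) auto
    show "(\<integral>\<^sup>+x\<in>A. emeasure (transition_kernel P X s x) B \<partial>\<pi>)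
        = (\<integral>\<^sup>+x\<in>B. emeasure (transition_kernel P X s x) A \<partial>\<pi>)"
      if "0 < s" "A \<in> sets \<pi>" "B \<in> sets \<pi>" for s A B
      using reversible that by (simp add: reversible_def sets_\<pi>)
  qed
  have semigroup_eq: "markov_semigroup P X s f x = T s f x"
    if "0 < s" "f \<in> borel_measurable borel" for s f x
  proof -
    interpret weak_solution "P x" F W "\<lambda>x. - DU x" "sqrt 2" x X
      by (rule D.solution)
    have "X s \<in> borel_measurable (P x)"
      using measurable_from_subalg[OF subalgebra_F adapted_X] that by auto
    then show ?thesis
      using that(2) by (simp add: markov_semigroup_def transition_kernel_def integral_distr)
  qed
  obtain g :: "real^'n \<Rightarrow> real" where g: "locally_Lp \<pi> 1 g"
    and tv: "\<And>s x. 0 < s \<Longrightarrow>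
      (\<integral>y. \<bar>p s x y / gibbs_density U y - 1\<bar> \<partial>\<pi>) \<le> g x * exp (\<rho> * s)"
    using assms(11) by blast
  have g_balls: "set_integrable \<pi> (cball 0 (real n)) g" for n
  proof -
    have [measurable]: "g \<in> borel_measurable borel"
      using g by (simp add: locally_Lp_def sets_\<pi> cong: measurable_cong_sets)
    have "set_integrable \<pi> (cball 0 (real n)) (\<lambda>x. norm (g x) powr 1)"
      using g by (simp add: locally_Lp_def)
    then have "set_integrable \<pi> (cball 0 (real n)) (\<lambda>x. \<bar>g x\<bar>)"
      by simp
    then show ?thesis
      unfolding set_integrable_def
      by (rule Bochner_Integration.integrable_bound) (auto simp: indicator_def)
  qed
  have decay: "\<bar>T s h x - (\<integral>y. h y \<partial>\<pi>)\<bar> \<le> B * (g x * exp (\<rho> * s))"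
    if s: "0 < s" and h: "h \<in> borel_measurable \<pi>" and B: "\<And>y. y \<in> space \<pi> \<Longrightarrow> \<bar>h y\<bar> \<le> B"
    for s x h B
  proof -
    interpret weak_solution "P x" F W "\<lambda>x. - DU x" "sqrt 2" x X
      by (rule D.solution)
    have hm: "h \<in> borel_measurable borel"
      using h by (simp add: sets_\<pi> cong: measurable_cong_sets)
    have "\<bar>(\<integral>\<omega>. h (X s \<omega>) \<partial>P x) - (\<integral>y. h y \<partial>\<pi>)\<bar>
        \<le> B * (\<integral>y. \<bar>p s x y / gibbs_density U y - 1\<bar> \<partial>\<pi>)"
      using assms(10) s B unfolding \<pi>_def
      by (intro integral_diff_le_total_variation[OF U _ _ prob_space_axioms hm])
        (auto simp: transition_density_def space_\<pi>[unfolded \<pi>_def])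
    also have "\<dots> \<le> B * (g x * exp (\<rho> * s))"
      using B[of x] tv[OF s, of x] by (intro mult_left_mono) (auto simp: space_\<pi>)
    finally show ?thesis
      using semigroup_eq[OF s hm, of x] by (simp add: markov_semigroup_def)
  qed
  have "(\<lambda>x. markov_semigroup P X t f x - (\<integral>y. f y \<partial>\<pi>)) \<in> L2 \<pi> \<and>
      L2_norm \<pi> (\<lambda>x. markov_semigroup P X t f x - (\<integral>y. f y \<partial>\<pi>)) \<le> exp (\<rho> * t) * L2_norm \<pi> f"
    if f: "f \<in> L2 \<pi>" for f
  proof -
    have "f \<in> borel_measurable borel"
      using f by (simp add: L2_def sets_\<pi> cong: measurable_cong_sets)
    then have eq: "markov_semigroup P X t f x = T t f x" for x
      by (rule semigroup_eq[OF t])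
    have balls: "cball 0 (real n) \<in> sets \<pi>" for n
      by (simp add: sets_\<pi>)
    have inc: "incseq (\<lambda>n. cball (0 :: real^'n) (real n))"
      by (auto simp: incseq_def)
    have un: "(\<Union>n. cball (0 :: real^'n) (real n)) = space \<pi>"
      by (auto simp: space_\<pi> real_arch_simple)
    show ?thesis
      unfolding eq by (intro conjI L2_decay[OF balls inc un g_balls decay t f])
  qed
  then show "L2_opnorm \<pi> (\<lambda>f x. markov_semigroup P X t f x - (\<integral>y. f y \<partial>\<pi>)) \<le> ennreal (exp (\<rho> * t))"
    unfolding L2_opnorm_def by (intro Inf_lower CollectI exI[of _ "exp (\<rho> * t)"]) auto
qed

end
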